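(* Suppose that $(A_{\text{true}},B_{\text{true}})\in\Sigma_{\text{cont}}$. Then the following statements are equivalent: (a) The data $\mathcal{D}$ are $\Sigma_{\text{cont}}$-informative for stabilization. (b) The data $\mathcal{D}$ are informative for stabilization. Moreover, if $K\in\mathbb{R}^{m\times n}$ is such that $A+BK$ is Schur for all $(A,B)\in\Sigma_{\mathcal{D}}\cap\Sigma_{\text{cont}}$, then $A+BK$ is Schur for all $(A,B)\in\Sigma_{\mathcal{D}}$.
   Context: Let $n,m,T$ be positive integers and $\mathcal{M}=\mathbb{R}^{n\times n}\times\mathbb{R}^{n\times m}$. Let $(A_{\text{true}},B_{\text{true}})\in\mathcal{M}$ be the (unknown) true system. The data $\mathcal{D}$ consist of inputs $u(0),\dots,u(T-1)\in\mathbb{R}^m$ and states $x(0),\dots,x(T)\in\mathbb{R}^n$ satisfying $x(t+1)=A_{\text{true}}x(t)+B_{\text{true}}u(t)$ for $t=0,\dots,T-1$. Set $U_-=\begin{bmatrix}u(0)&\cdots&u(T-1)\end{bmatrix}$, $X_-=\begin{bmatrix}x(0)&\cdots&x(T-1)\end{bmatrix}$, $X_+=\begin{bmatrix}x(1)&\cdots&x(T)\end{bmatrix}$. The set of data-consistent systems is $\Sigma_{\mathcal{D}}=\{(A,B)\in\mathcal{M}\mid X_+=AX_-+BU_-\}$. The set $\Sigma_{\text{cont}}$ is the set of all controllable pairs $(A,B)\in\mathcal{M}$. A real square matrix is Schur if all its eigenvalues have modulus strictly less than $1$. For $\Sigma_{\text{pk}}\subseteq\mathcal{M}$, the data $\mathcal{D}$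 are called $\Sigma_{\text{pk}}$-informative for stabilization if there exists a single $K\in\mathbb{R}^{m\times n}$ such that $A+BK$ is Schur for all $(A,B)\in\Sigma_{\mathcal{D}}\cap\Sigma_{\text{pk}}$; they are called informative for stabilization if this holds with $\Sigma_{\text{pk}}=\mathcal{M}$. *)

theory Defs
  imports Complex_Main "Jordan_Normal_Form.Char_Poly"
begin

definition systems :: "nat \<Rightarrow> nat \<Rightarrow> (real mat \<times> real mat) set" where
  "systems n m = carrier_mat n n \<times> carrier_mat n m"

definition U_minus :: "nat \<Rightarrow> nat \<Rightarrow> (nat \<Rightarrow> real vec) \<Rightarrow> real mat" where
  "U_minus m T u = mat_of_cols m (map u [0..<T])"

definition X_minus :: "nat \<Rightarrow> nat \<Rightarrow> (nat \<Rightarrow> real vec) \<Rightarrow> real mat" where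
  "X_minus n T x = mat_of_cols n (map x [0..<T])"

definition X_plus :: "nat \<Rightarrow> nat \<Rightarrow> (nat \<Rightarrow> real vec) \<Rightarrow> real mat" where
  "X_plus n T x = mat_of_cols n (map x [1..<Suc T])"

definition Sigma_D ::
  "nat \<Rightarrow> nat \<Rightarrow> nat \<Rightarrow> (nat \<Rightarrow> real vec) \<Rightarrow> (nat \<Rightarrow> real vec) \<Rightarrow> (real mat \<times> real mat) set" where
  "Sigma_D n m T u x =
     {(A, B) \<in> systems n m. X_plus n T x = A * X_minus n T x + B * U_minus m T u}"

primrec state ::
  "real mat \<Rightarrow> real mat \<Rightarrow> (nat \<Rightarrow> real vec) \<Rightarrow> real vec \<Rightarrow> nat \<Rightarrow> real vec" where
  "state A B v z 0 = z"
| "state A B v z (Suc t) = A *\<^sub>v state A B v z t + B *\<^sub>v v t"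

(* Controllability is transfer between arbitrary states, not just steering to the origin
   (null-controllability is strictly weaker in discrete time). *)
definition controllable :: "nat \<Rightarrow> nat \<Rightarrow> real mat \<Rightarrow> real mat \<Rightarrow> bool" where
  "controllable n m A B \<longleftrightarrow>
     (\<forall>z \<in> carrier_vec n. \<forall>w \<in> carrier_vec n.
        \<exists>N v. (\<forall>t. v t \<in> carrier_vec m) \<and> state A B v z N = w)"

definition Sigma_cont :: "nat \<Rightarrow> nat \<Rightarrow> (real mat \<times> real mat) set" where
  "Sigma_cont n m = {(A, B) \<in> systems n m. controllable n m A B}"

definition schur :: "real mat \<Rightarrow> bool" where
  "schur M \<longleftrightarrow> square_mat M \<and>
     (\<forall>l. eigenvalue (map_mat complex_of_real M) l \<longrightarrow> cmod l < 1)"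

definition informative_wrt ::
  "nat \<Rightarrow> nat \<Rightarrow> nat \<Rightarrow> (nat \<Rightarrow> real vec) \<Rightarrow> (nat \<Rightarrow> real vec) \<Rightarrow> (real mat \<times> real mat) set \<Rightarrow> bool" where
  "informative_wrt n m T u x S \<longleftrightarrow>
     (\<exists>K \<in> carrier_mat m n. \<forall>(A, B) \<in> Sigma_D n m T u x \<inter> S. schur (A + B * K))"

definition informative ::
  "nat \<Rightarrow> nat \<Rightarrow> nat \<Rightarrow> (nat \<Rightarrow> real vec) \<Rightarrow> (nat \<Rightarrow> real vec) \<Rightarrow> bool" where
  "informative n m T u x \<longleftrightarrow> informative_wrt n m T u x (systems n m)"

end

theory Submission
  imports Defs
begin

text \<open>
  Join the true system to another data-consistent system by an affine line inside \<^const>\<open>Sigma_D\<close>.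
  Controllability is certified by the nonvanishing of a determinant that depends polynomially on the
  line parameter \<open>s\<close>, so all but finitely many systems on the line are controllable and hence
  stabilized by \<open>K\<close>. For fixed \<open>z\<close>, the value at \<open>z\<close> of the characteristic polynomial of
  \<open>A + B K\<close> is polynomial in \<open>s\<close>, and where the matrix is Schur its modulus is at most
  \<open>(\<bar>z\<bar> + 1)^n\<close>. A polynomial bounded off a finite set is constant; so the characteristic
  polynomial is the same along the whole line, and the Schur property holds at both ends.
\<close>

section \<open>Scalar functions polynomial in a real parameter\<close>

text \<open>The parameter stays real while the values lie in any real field, so that one notion
  serves both the real controllability determinant and the complex values of characteristic
  polynomials.\<close>

definition poly_fun :: "(real \<Rightarrow> 'a::real_field) \<Rightarrow> bool" where
  "poly_fun f \<longleftrightarrow> (\<exists>p. \<forall>s. f s = poly p (of_real s))"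

lemma poly_fun_const: "poly_fun (\<lambda>s. c)"
  unfolding poly_fun_def by (rule exI[of _ "[:c:]"]) simp

lemma poly_fun_of_real: "poly_fun of_real"
  unfolding poly_fun_def by (rule exI[of _ "[:0, 1:]"]) simp

lemma poly_fun_add: "poly_fun f \<Longrightarrow> poly_fun g \<Longrightarrow> poly_fun (\<lambda>s. f s + g s)"
  unfolding poly_fun_def by (metis poly_add)

lemma poly_fun_mult: "poly_fun f \<Longrightarrow> poly_fun g \<Longrightarrow> poly_fun (\<lambda>s. f s * g s)"
  unfolding poly_fun_def by (metis poly_mult)

lemma poly_fun_uminus: "poly_fun f \<Longrightarrow> poly_fun (\<lambda>s. - f s)"
  using poly_fun_mult[OF poly_fun_const[of "- 1"], of f] by simp

lemma poly_fun_sum: "(\<And>i. i \<in> I \<Longrightarrow> poly_fun (f i)) \<Longrightarrow> poly_fun (\<lambda>s. \<Sum>i\<in>I. f i s)"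
  by (induction I rule: infinite_finite_induct) (simp_all add: poly_fun_const poly_fun_add)

lemma poly_fun_prod: "(\<And>i. i \<in> I \<Longrightarrow> poly_fun (f i)) \<Longrightarrow> poly_fun (\<lambda>s. \<Prod>i\<in>I. f i s)"
  by (induction I rule: infinite_finite_induct) (simp_all add: poly_fun_const poly_fun_mult)

lemma poly_fun_complex_of_real:
  assumes "poly_fun (f :: real \<Rightarrow> real)"
  shows "poly_fun (\<lambda>s. complex_of_real (f s))"
proof -
  obtain p where p: "\<And>s. f s = poly p s"
    using assms unfolding poly_fun_def by auto
  have "complex_of_real (f s) = poly (map_poly of_real p) (of_real s)" for s
    unfolding p by (simp add: of_real_hom.poly_map_poly)
  then show ?thesis unfolding poly_fun_def by blast
qed

lemma poly_fun_finite_zeros: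
  assumes "poly_fun (f :: real \<Rightarrow> real)" and "f a \<noteq> 0"
  shows "finite {s. f s = 0}"
proof -
  obtain p where p: "\<And>s. f s = poly p s"
    using assms(1) unfolding poly_fun_def by auto
  with assms(2) have "p \<noteq> 0" by auto
  then show ?thesis unfolding p by (rule poly_roots_finite)
qed

text \<open>A nonconstant polynomial tends to infinity in modulus, in particular along the positive
  real axis, where a finite set \<open>S\<close> cannot cover all large arguments.\<close>

lemma poly_fun_bounded_imp_const:
  assumes "poly_fun (f :: real \<Rightarrow> complex)" and "finite S"
    and bound: "\<And>s. s \<notin> S \<Longrightarrow> cmod (f s) \<le> C"
  shows "f a = f b"
proof -
  obtain p where p: "\<And>s. f s = poly p (of_real s)"
    using assms(1) unfolding poly_fun_def by auto
  \<comment> \<open>\<open>poly p z = c + z * poly q z\<close>, so \<open>p\<close> is constant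
    exactly when \<open>q = 0\<close>; otherwise \<open>poly_infinity\<close> applies.\<close>
  obtain c q where pq: "p = pCons c q" by (cases p)
  show ?thesis
  proof (cases "q = 0")
    case True
    then show ?thesis by (simp add: p pq)
  next
    case False
    from poly_infinity[OF this, of "C + 1" c] obtain r
      where r: "\<And>z. r \<le> cmod z \<Longrightarrow> C + 1 \<le> cmod (poly (pCons c q) z)" by blast
    have "infinite ({\<bar>r\<bar>..} - S)"
      using assms(2) infinite_Ici by (rule Diff_infinite_finite)
    then obtain s where s: "s \<ge> \<bar>r\<bar>" "s \<notin> S"
      by (metis Diff_iff atLeast_iff ex_in_conv finite.emptyI)
    have "C + 1 \<le> cmod (f s)" unfolding p pq by (rule r) (use s in auto)
    with bound[OF s(2)] show ?thesis by simp
  qed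
qed

section \<open>Matrices with polynomial entries, their determinants and characteristic
  polynomials\<close>

definition poly_mat :: "nat \<Rightarrow> nat \<Rightarrow> (real \<Rightarrow> 'a::real_field mat) \<Rightarrow> bool" where
  "poly_mat nr nc M \<longleftrightarrow>
     (\<forall>s. M s \<in> carrier_mat nr nc) \<and> (\<forall>i<nr. \<forall>j<nc. poly_fun (\<lambda>s. M s $$ (i, j)))"

lemma poly_mat_carrier: "poly_mat nr nc M \<Longrightarrow> M s \<in> carrier_mat nr nc"
  unfolding poly_mat_def by auto

lemma poly_mat_const: "M \<in> carrier_mat nr nc \<Longrightarrow> poly_mat nr nc (\<lambda>s. M)"
  unfolding poly_mat_def by (simp add: poly_fun_const)

lemma poly_mat_add:
  assumes "poly_mat nr nc M" and "poly_mat nr nc N"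
  shows "poly_mat nr nc (\<lambda>s. M s + N s)"
proof -
  have M: "M s \<in> carrier_mat nr nc" and N: "N s \<in> carrier_mat nr nc" for s
    using assms by (auto intro: poly_mat_carrier)
  have "(M s + N s) $$ (i, j) = M s $$ (i, j) + N s $$ (i, j)" if "i < nr" "j < nc" for s i j
    using M[of s] N[of s] that by simp
  then show ?thesis
    using assms unfolding poly_mat_def by (simp add: poly_fun_add)
qed

lemma poly_mat_smult:
  assumes "poly_fun f" and "M \<in> carrier_mat nr nc"
  shows "poly_mat nr nc (\<lambda>s. f s \<cdot>\<^sub>m M)"
  using assms unfolding poly_mat_def by (auto intro!: poly_fun_mult poly_fun_const)

lemma poly_mat_mult:
  assumes "poly_mat nr nk M" and "poly_mat nk nc N"
  shows "poly_mat nr nc (\<lambda>s. M s * N s)"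
proof -
  have M: "M s \<in> carrier_mat nr nk" and N: "N s \<in> carrier_mat nk nc" for s
    using assms by (auto intro: poly_mat_carrier)
  have "(M s * N s) $$ (i, j) = (\<Sum>k\<in>{0..<nk}. M s $$ (i, k) * N s $$ (k, j))"
    if "i < nr" "j < nc" for s i j
    using M[of s] N[of s] that by (simp add: scalar_prod_def)
  moreover have "M s * N s \<in> carrier_mat nr nc" for s
    using M N by (rule mult_carrier_mat)
  ultimately show ?thesis
    using assms unfolding poly_mat_def
    by (auto intro!: poly_fun_sum poly_fun_mult)
qed

text \<open>The Leibniz formula builds the determinant from the entries by finite sums and
  products.\<close>

lemma poly_fun_det:
  assumes "poly_mat n n M"
  shows "poly_fun (\<lambda>s. det (M s))"
proof -
  have "det (M s) = (\<Sum>p\<in>{p. p permutes {0..<n}}. signof p * (\<Prod>i = 0..<n. M s $$ (i, p i)))" for s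
    using poly_mat_carrier[OF assms] by (rule det_def')
  moreover have "p i < n" if "p permutes {0..<n}" "i < n" for p i
    using permutes_in_image[OF that(1), of i] that(2) by simp
  ultimately show ?thesis
    using assms unfolding poly_mat_def
    by (auto intro!: poly_fun_sum poly_fun_mult poly_fun_prod poly_fun_const)
qed

text \<open>With \<open>z\<close> fixed, the value is the determinant of \<open>z\<close> times the
  identity minus \<open>M s\<close>, whose entries are polynomial in \<open>s\<close>.\<close>

lemma poly_fun_char_poly:
  assumes "poly_mat n n M"
  shows "poly_fun (\<lambda>s. poly (char_poly (map_mat complex_of_real (M s))) z)"
proof -
  let ?C = "\<lambda>s. map_mat complex_of_real (M s)"
  have M: "M s \<in> carrier_mat n n" for s using assms by (rule poly_mat_carrier)
  have "poly_mat n n (\<lambda>s. - char_matrix (?C s) z)"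
    unfolding poly_mat_def
  proof (intro conjI allI impI)
    show "- char_matrix (?C s) z \<in> carrier_mat n n" for s using M[of s] by simp
    fix i j assume ij: "i < n" "j < n"
    have "(- char_matrix (?C s) z) $$ (i, j)
        = - (complex_of_real (M s $$ (i, j)) + (- z) * (1\<^sub>m n $$ (i, j)))" for s
      using M[of s] ij by (simp add: char_matrix_def)
    moreover have "poly_fun (\<lambda>s. M s $$ (i, j))" using assms ij unfolding poly_mat_def by blast
    ultimately show "poly_fun (\<lambda>s. (- char_matrix (?C s) z) $$ (i, j))"
      by (simp only:) (intro poly_fun_uminus poly_fun_add poly_fun_const poly_fun_complex_of_real)
  qed
  then have "poly_fun (\<lambda>s. det (- char_matrix (?C s) z))" by (rule poly_fun_det)
  moreover have "poly (char_poly (?C s)) z = det (- char_matrix (?C s) z)" for s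
    by (rule char_poly_matrix[of _ n]) (use M in simp)
  ultimately show ?thesis by simp
qed

text \<open>Over the complex numbers the characteristic polynomial splits into \<open>n\<close>
  factors \<open>z - a\<close>, where each \<open>a\<close> is an eigenvalue of modulus below 1. The
  bound depends on \<open>z\<close> and \<open>n\<close> but not on \<open>M\<close>, hence is
  uniform along a family of Schur matrices.\<close>

lemma schur_char_poly_bound:
  assumes "schur M" and M: "M \<in> carrier_mat n n"
  shows "cmod (poly (char_poly (map_mat complex_of_real M)) z) \<le> (cmod z + 1) ^ n"
proof -
  let ?C = "map_mat complex_of_real M"
  have C: "?C \<in> carrier_mat n n" using M by simp
  obtain as where as: "char_poly ?C = (\<Prod>a\<leftarrow>as. [:- a, 1:])" "length as = n"
    using char_poly_factorized[OF C] by blast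
  have small: "cmod a \<le> 1" if "a \<in> set as" for a
  proof -
    have "poly (char_poly ?C) a = 0" using that
      by (simp add: as poly_prod_list prod_list_zero_iff)
    then have "eigenvalue ?C a" using eigenvalue_root_char_poly[OF C] by simp
    then show ?thesis using assms(1) unfolding schur_def by force
  qed
  \<comment> \<open>The induction runs over lists of roots drawn from \<open>as\<close>, so that
    \<open>small\<close> applies at every step.\<close>
  have "cmod (poly (\<Prod>a\<leftarrow>bs. [:- a, 1:]) z) \<le> (cmod z + 1) ^ length bs"
    if "set bs \<subseteq> set as" for bs using that
  proof (induction bs)
    case (Cons b bs)
    have "cmod (z - b) \<le> cmod z + 1"
      using norm_triangle_ineq4[of z b] small[of b] Cons.prems by simp
    moreover have "poly (\<Prod>a\<leftarrow>b # bs. [:- a, 1:]) z = (z - b) * poly (\<Prod>a\<leftarrow>bs. [:- a, 1:]) z"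
      by (simp add: algebra_simps)
    ultimately show ?case using Cons by (simp only: norm_mult) (auto intro!: mult_mono)
  qed simp
  from this[of as] show ?thesis using as by simp
qed

section \<open>Controllability as nonsingularity of \<open>mat_state\<close>\<close>

text \<open>Column \<open>i\<close> is the state reached from the origin when the inputs are the \<open>i\<close>-th columns of \<open>V\<close>.\<close>

primrec mat_state ::
  "real mat \<Rightarrow> real mat \<Rightarrow> (nat \<Rightarrow> real mat) \<Rightarrow> nat \<Rightarrow> real mat" where
  "mat_state A B V 0 = 0\<^sub>m (dim_row A) (dim_row A)"
| "mat_state A B V (Suc t) = A * mat_state A B V t + B * V t"

context
  fixes n m :: nat and A B :: "real mat"
  assumes A: "A \<in> carrier_mat n n" and B: "B \<in> carrier_mat n m"
begin

lemma state_carrier: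
  assumes "\<And>t. v t \<in> carrier_vec m" and "z \<in> carrier_vec n"
  shows "state A B v z t \<in> carrier_vec n"
  using assms A B by (induction t) auto

text \<open>Linearity separates the free response to \<open>z\<close> from the forced response to
  \<open>v\<close>.\<close>

lemma state_superposition:
  assumes v: "\<And>t. v t \<in> carrier_vec m" and z: "z \<in> carrier_vec n"
  shows "state A B v z t = state A B (\<lambda>_. 0\<^sub>v m) z t + state A B v (0\<^sub>v n) t"
proof (induction t)
  case 0
  then show ?case using z by simp
next
  case (Suc t)
  let ?p = "state A B (\<lambda>_. 0\<^sub>v m) z t" and ?q = "state A B v (0\<^sub>v n) t"
  have p: "?p \<in> carrier_vec n" and q: "?q \<in> carrier_vec n"
    using state_carrier v z by auto
  have "B *\<^sub>v 0\<^sub>v m = 0\<^sub>v n" using B by (intro eq_vecI) auto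
  moreover have "A *\<^sub>v (?p + ?q) = A *\<^sub>v ?p + A *\<^sub>v ?q"
    by (rule mult_add_distrib_mat_vec[OF A p q])
  ultimately show ?case
    using Suc A B p q v[of t] by (simp add: assoc_add_vec[of _ n])
qed

text \<open>Under zero input the origin is at rest, so a steering from the origin can be postponed
  by \<open>k\<close> steps. This brings steerings of different lengths to a common horizon.\<close>

lemma state_delay:
  "state A B (\<lambda>t. if t < k then 0\<^sub>v m else v (t - k)) (0\<^sub>v n) (k + t) = state A B v (0\<^sub>v n) t"
proof -
  have zero: "A *\<^sub>v 0\<^sub>v n = 0\<^sub>v n" "B *\<^sub>v 0\<^sub>v m = 0\<^sub>v n"
    using A B by (auto intro!: eq_vecI)
  have "state A B (\<lambda>t. if t < k then 0\<^sub>v m else v (t - k)) (0\<^sub>v n) j = 0\<^sub>v n" if "j \<le> k" for j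
    using that by (induction j) (auto simp: zero)
  then show ?thesis by (induction t) auto
qed

lemma mat_state_carrier:
  assumes "\<And>t. V t \<in> carrier_mat m n"
  shows "mat_state A B V t \<in> carrier_mat n n"
  using assms A B by (induction t) auto

lemma state_mat_state:
  assumes V: "\<And>t. V t \<in> carrier_mat m n" and c: "c \<in> carrier_vec n"
  shows "state A B (\<lambda>t. V t *\<^sub>v c) (0\<^sub>v n) t = mat_state A B V t *\<^sub>v c"
proof (induction t)
  case 0
  then show ?case using A c by (intro eq_vecI) auto
next
  case (Suc t)
  have S: "mat_state A B V t \<in> carrier_mat n n" using V by (rule mat_state_carrier)
  have "mat_state A B V (Suc t) *\<^sub>v c = (A * mat_state A B V t) *\<^sub>v c + (B * V t) *\<^sub>v c"
    using A B S V[of t] c by (simp add: add_mult_distrib_mat_vec[of _ n n])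
  also have "\<dots> = A *\<^sub>v (mat_state A B V t *\<^sub>v c) + B *\<^sub>v (V t *\<^sub>v c)"
    using assoc_mult_mat_vec[OF A S c] assoc_mult_mat_vec[OF B V c] by simp
  finally show ?case using Suc by simp
qed

text \<open>The inputs \<open>V t *\<^sub>v c\<close> add
  \<open>mat_state A B V N *\<^sub>v c\<close> to the free response; a nonzero determinant lets
  \<open>c\<close> be chosen to make up any difference to the target.\<close>

lemma controllable_if_det_mat_state:
  assumes V: "\<And>t. V t \<in> carrier_mat m n" and det: "det (mat_state A B V N) \<noteq> 0"
  shows "controllable n m A B"
  unfolding controllable_def
proof (intro ballI)
  fix z w :: "real vec" assume z: "z \<in> carrier_vec n" and w: "w \<in> carrier_vec n"
  let ?S = "mat_state A B V N"
  define y where "y = state A B (\<lambda>_. 0\<^sub>v m) z N"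
  \<comment> \<open>\<open>c\<close> is the inverse of \<open>?S\<close> applied to
    \<open>w - y\<close>, with the inverse written through the adjugate.\<close>
  define c where "c = (1 / det ?S) \<cdot>\<^sub>v (adj_mat ?S *\<^sub>v (w - y))"
  have S: "?S \<in> carrier_mat n n" using V by (rule mat_state_carrier)
  have y: "y \<in> carrier_vec n" unfolding y_def using state_carrier z by simp
  have adj: "adj_mat ?S \<in> carrier_mat n n" "?S * adj_mat ?S = det ?S \<cdot>\<^sub>m 1\<^sub>m n"
    using adj_mat[OF S] by auto
  have c: "c \<in> carrier_vec n" unfolding c_def using adj w y by auto
  have wy: "w - y \<in> carrier_vec n" using w y by simp
  have "?S *\<^sub>v c = (1 / det ?S) \<cdot>\<^sub>v ((?S * adj_mat ?S) *\<^sub>v (w - y))"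
    unfolding c_def assoc_mult_mat_vec[OF S adj(1) wy]
    by (rule mult_mat_vec[OF S mult_mat_vec_carrier[OF adj(1) wy]])
  also have "\<dots> = w - y"
    unfolding adj using det w y by (intro eq_vecI) auto
  finally have Sc: "?S *\<^sub>v c = w - y" .
  have Vc: "V t *\<^sub>v c \<in> carrier_vec m" for t using V c by (rule mult_mat_vec_carrier)
  have "state A B (\<lambda>t. V t *\<^sub>v c) z N = w"
    unfolding state_superposition[OF Vc z] state_mat_state[OF V c] Sc y_def[symmetric]
    using w y by (intro eq_vecI) auto
  then show "\<exists>N v. (\<forall>t. v t \<in> carrier_vec m) \<and> state A B v z N = w"
    using Vc by (intro exI[of _ N] exI[of _ "\<lambda>t. V t *\<^sub>v c"]) simp
qed

text \<open>Each unit vector is reachable from the origin. Once the arrival times agree, the input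
  sequences serve as the columns of \<open>V\<close>.\<close>

lemma controllable_imp_mat_state_one:
  assumes "controllable n m A B"
  obtains V N where "\<And>t. V t \<in> carrier_mat m n" and "mat_state A B V N = 1\<^sub>m n"
proof -
  have "\<forall>i. \<exists>k v. (\<forall>t. v t \<in> carrier_vec m) \<and> state A B v (0\<^sub>v n) k = unit_vec n i"
    using assms unfolding controllable_def by simp
  then obtain k v where v: "\<And>i t. v i t \<in> carrier_vec m"
    and reach: "\<And>i. state A B (v i) (0\<^sub>v n) (k i) = unit_vec n i"
    by metis
  \<comment> \<open>The arrival times \<open>k i\<close> may differ; their sum is a convenient
    common upper bound.\<close>
  define N where "N = (\<Sum>i<n. k i)"
  have kN: "k i \<le> N" if "i < n" for i
    unfolding N_def using that by (intro member_le_sum) auto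
  \<comment> \<open>Waiting \<open>N - k i\<close> steps makes the \<open>i\<close>-th steering
    arrive exactly at time \<open>N\<close>.\<close>
  define v' where "v' i t = (if t < N - k i then 0\<^sub>v m else v i (t - (N - k i)))" for i t
  define V where "V t = mat_of_cols m (map (\<lambda>i. v' i t) [0..<n])" for t
  have v': "v' i t \<in> carrier_vec m" for i t unfolding v'_def using v by simp
  have V: "V t \<in> carrier_mat m n" for t unfolding V_def by auto
  have "mat_state A B V N *\<^sub>v unit_vec n i = unit_vec n i" if i: "i < n" for i
  proof -
    have "V t *\<^sub>v unit_vec n i = v' i t" for t
      using V[of t] v'[of i t] i
      by (intro eq_vecI) (auto simp: V_def mat_of_cols_index)
    then have "mat_state A B V N *\<^sub>v unit_vec n i = state A B (v' i) (0\<^sub>v n) N"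
      using state_mat_state[where V = V and c = "unit_vec n i" and t = N] V by simp
    also have "\<dots> = unit_vec n i"
      using state_delay[where k = "N - k i" and v = "v i" and t = "k i"] kN[OF i] reach[of i]
      by (simp add: v'_def[abs_def])
    finally show ?thesis .
  qed
  moreover have S: "mat_state A B V N \<in> carrier_mat n n" using V by (rule mat_state_carrier)
  moreover have "mat_state A B V N $$ (j, i) = (mat_state A B V N *\<^sub>v unit_vec n i) $ j"
    if "i < n" "j < n" for i j
    using S that by simp
  ultimately have "mat_state A B V N = 1\<^sub>m n"
    by (intro eq_matI) auto
  with V show ?thesis using that by blast
qed

end

section \<open>Controllability and the Schur property along polynomial families\<close>

lemma poly_mat_mat_state:
  assumes A: "poly_mat n n A" and B: "poly_mat n m B" and V: "\<And>t. V t \<in> carrier_mat m n"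
  shows "poly_mat n n (\<lambda>s. mat_state (A s) (B s) V t)"
proof (induction t)
  case 0
  have "dim_row (A s) = n" for s using poly_mat_carrier[OF A, of s] by auto
  then show ?case by (simp add: poly_mat_const)
next
  case (Suc t)
  then show ?case
    by (simp add: poly_mat_add poly_mat_mult[OF A] poly_mat_mult[OF B poly_mat_const[OF V]])
qed

text \<open>\<open>V\<close> and \<open>N\<close> are taken from the system at \<open>a\<close> and
  then kept for all \<open>s\<close>. The determinant equals 1 at \<open>a\<close>, so it has
  finitely many zeros, and every uncontrollable parameter is among them.\<close>

lemma finite_uncontrollable:
  assumes A: "poly_mat n n A" and B: "poly_mat n m B" and "controllable n m (A a) (B a)"
  shows "finite {s. \<not> controllable n m (A s) (B s)}"
proof -
  have AB: "A s \<in> carrier_mat n n" "B s \<in> carrier_mat n m" for s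
    using A B by (auto intro: poly_mat_carrier)
  obtain V N where V: "\<And>t. V t \<in> carrier_mat m n" and one: "mat_state (A a) (B a) V N = 1\<^sub>m n"
    using controllable_imp_mat_state_one[OF AB assms(3)] by metis
  let ?f = "\<lambda>s. det (mat_state (A s) (B s) V N)"
  have "poly_fun ?f" using poly_mat_mat_state[OF A B V] by (rule poly_fun_det)
  moreover have "?f a \<noteq> 0" by (simp add: one)
  ultimately have "finite {s. ?f s = 0}" by (rule poly_fun_finite_zeros)
  then show ?thesis
    by (rule rev_finite_subset) (auto intro: ccontr dest: controllable_if_det_mat_state[OF AB V])
qed

text \<open>\<open>a\<close> may itself lie in the exceptional set: the constant characteristic
  polynomial carries the eigenvalues at some \<open>b\<close> outside \<open>S\<close> over to
  \<open>a\<close>.\<close>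

lemma schur_along_poly_mat:
  assumes M: "poly_mat n n M" and "finite S" and schur: "\<And>s. s \<notin> S \<Longrightarrow> schur (M s)"
  shows "schur (M a)"
proof -
  let ?C = "\<lambda>s. map_mat complex_of_real (M s)"
  have carrier: "M s \<in> carrier_mat n n" for s using M by (rule poly_mat_carrier)
  then have C: "?C s \<in> carrier_mat n n" for s by simp
  obtain b where b: "b \<notin> S"
    using \<open>finite S\<close> ex_new_if_finite infinite_UNIV_char_0 by blast
  have "poly (char_poly (?C a)) z = poly (char_poly (?C b)) z" for z
    using poly_fun_char_poly[OF M] \<open>finite S\<close> schur_char_poly_bound[OF schur carrier]
    by (rule poly_fun_bounded_imp_const)
  then have "eigenvalue (?C a) l \<longleftrightarrow> eigenvalue (?C b) l" for l
    by (simp add: eigenvalue_root_char_poly[OF C])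
  then show ?thesis
    using schur[OF b] carrier[of a] unfolding schur_def by auto
qed

section \<open>Lines of data-consistent systems\<close>

lemma trajectory_in_Sigma_D:
  assumes "(A, B) \<in> systems n m"
    and u: "\<And>t. t < T \<Longrightarrow> u t \<in> carrier_vec m"
    and x: "\<And>t. t \<le> T \<Longrightarrow> x t \<in> carrier_vec n"
    and step: "\<And>t. t < T \<Longrightarrow> x (Suc t) = A *\<^sub>v x t + B *\<^sub>v u t"
  shows "(A, B) \<in> Sigma_D n m T u x"
proof -
  have A: "A \<in> carrier_mat n n" and B: "B \<in> carrier_mat n m"
    using assms(1) unfolding systems_def by auto
  have X: "X_minus n T x \<in> carrier_mat n T" and U: "U_minus m T u \<in> carrier_mat m T"
    unfolding X_minus_def U_minus_def by auto
  have "X_plus n T x = A * X_minus n T x + B * U_minus m T u"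
  proof (rule eq_matI)
    fix i j
    assume "i < dim_row (A * X_minus n T x + B * U_minus m T u)"
      and "j < dim_col (A * X_minus n T x + B * U_minus m T u)"
    then have i: "i < n" and j: "j < T" using B U by auto
    have "col (X_minus n T x) j = x j"
      unfolding X_minus_def using j x[of j] by (subst col_mat_of_cols) auto
    moreover have "col (U_minus m T u) j = u j"
      unfolding U_minus_def using j u[of j] by (subst col_mat_of_cols) auto
    \<comment> \<open>The list of columns starts at time 1, so column \<open>j\<close> is
      \<open>x (Suc j)\<close>; unfolding \<open>upt_Suc\<close> would split off the last
      column.\<close>
    moreover have "X_plus n T x $$ (i, j) = x (Suc j) $ i"
      unfolding X_plus_def using i j by (simp add: mat_of_cols_index del: upt_Suc)
    ultimately show "X_plus n T x $$ (i, j) = (A * X_minus n T x + B * U_minus m T u) $$ (i, j)"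
      using A B X U i j step[OF j] by simp
  qed (use B U in \<open>auto simp: X_plus_def\<close>)
  with assms(1) show ?thesis unfolding Sigma_D_def by simp
qed

text \<open>The data equation is linear in the pair and the weights \<open>1 - s\<close> and
  \<open>s\<close> sum to 1; no sign of \<open>s\<close> is involved, so the whole line is
  covered.\<close>

lemma Sigma_D_affine:
  assumes "(A, B) \<in> Sigma_D n m T u x" and "(A', B') \<in> Sigma_D n m T u x"
  shows "((1 - s) \<cdot>\<^sub>m A + s \<cdot>\<^sub>m A', (1 - s) \<cdot>\<^sub>m B + s \<cdot>\<^sub>m B') \<in> Sigma_D n m T u x"
proof -
  let ?X = "X_minus n T x" and ?U = "U_minus m T u" and ?Y = "X_plus n T x"
  have AB: "A \<in> carrier_mat n n" "B \<in> carrier_mat n m" "A' \<in> carrier_mat n n" "B' \<in> carrier_mat n m"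
    and Y: "?Y = A * ?X + B * ?U" "?Y = A' * ?X + B' * ?U"
    using assms unfolding Sigma_D_def systems_def by auto
  have X: "?X \<in> carrier_mat n T" and U: "?U \<in> carrier_mat m T"
    unfolding X_minus_def U_minus_def by auto
  have "((1 - s) \<cdot>\<^sub>m A + s \<cdot>\<^sub>m A') * ?X + ((1 - s) \<cdot>\<^sub>m B + s \<cdot>\<^sub>m B') * ?U
      = ((1 - s) \<cdot>\<^sub>m (A * ?X) + s \<cdot>\<^sub>m (A' * ?X)) + ((1 - s) \<cdot>\<^sub>m (B * ?U) + s \<cdot>\<^sub>m (B' * ?U))"
    using AB X U
    by (simp add: add_mult_distrib_mat[of _ n n] add_mult_distrib_mat[of _ n m]
        mult_smult_assoc_mat[of _ n n] mult_smult_assoc_mat[of _ n m])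
  also have "\<dots> = (1 - s) \<cdot>\<^sub>m (A * ?X + B * ?U) + s \<cdot>\<^sub>m (A' * ?X + B' * ?U)"
    using AB X U by (intro eq_matI) (auto simp: algebra_simps)
  also have "\<dots> = ?Y"
    unfolding Y[symmetric] by (intro eq_matI) (auto simp: algebra_simps)
  finally show ?thesis
    using AB unfolding Sigma_D_def systems_def by simp
qed

lemma schur_on_Sigma_D:
  assumes true: "(A0, B0) \<in> Sigma_D n m T u x \<inter> Sigma_cont n m"
    and K: "K \<in> carrier_mat m n"
    and stab: "\<And>A B. (A, B) \<in> Sigma_D n m T u x \<inter> Sigma_cont n m \<Longrightarrow> schur (A + B * K)"
    and AB: "(A, B) \<in> Sigma_D n m T u x"
  shows "schur (A + B * K)"
proof -
  define A' where "A' s = (1 - s) \<cdot>\<^sub>m A0 + s \<cdot>\<^sub>m A" for s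
  define B' where "B' s = (1 - s) \<cdot>\<^sub>m B0 + s \<cdot>\<^sub>m B" for s
  have c: "A0 \<in> carrier_mat n n" "B0 \<in> carrier_mat n m" "A \<in> carrier_mat n n" "B \<in> carrier_mat n m"
    and cont0: "controllable n m A0 B0"
    using true AB unfolding Sigma_D_def Sigma_cont_def systems_def by auto
  have lin: "poly_fun (\<lambda>s. 1 - s :: real)" "poly_fun (\<lambda>s. s :: real)"
    using poly_fun_add[OF poly_fun_const[of "1 :: real"] poly_fun_uminus[OF poly_fun_of_real]]
      poly_fun_of_real[where 'a = real] by (simp_all add: id_def)
  have A': "poly_mat n n A'" and B': "poly_mat n m B'"
    unfolding A'_def B'_def by (intro poly_mat_add poly_mat_smult lin c)+
  \<comment> \<open>Parameter 0 supplies one controllable system, and parameter 1 is the system to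
    be stabilized.\<close>
  have ends: "A' 0 = A0" "B' 0 = B0" "A' 1 = A" "B' 1 = B"
    unfolding A'_def B'_def using c by (auto intro!: eq_matI)
  have "finite {s. \<not> controllable n m (A' s) (B' s)}"
    using finite_uncontrollable[OF A' B', of 0] cont0 ends by simp
  moreover have "schur (A' s + B' s * K)" if "s \<notin> {s. \<not> controllable n m (A' s) (B' s)}" for s
  proof (rule stab)
    have "(A' s, B' s) \<in> Sigma_D n m T u x"
      unfolding A'_def B'_def using true AB by (intro Sigma_D_affine) auto
    then show "(A' s, B' s) \<in> Sigma_D n m T u x \<inter> Sigma_cont n m"
      using that unfolding Sigma_D_def Sigma_cont_def by auto
  qed
  ultimately have "schur (A' 1 + B' 1 * K)"
    by (rule schur_along_poly_mat[OF poly_mat_add[OF A' poly_mat_mult[OF B' poly_mat_const[OF K]]]])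
  then show ?thesis by (simp add: ends)
qed

theorem theorem5:
  fixes n m T :: nat
    and A_true B_true :: "real mat"
    and u x :: "nat \<Rightarrow> real vec"
  assumes "n > 0" and "m > 0" and "T > 0"
    and "\<And>t. t < T \<Longrightarrow> u t \<in> carrier_vec m"
    and "\<And>t. t \<le> T \<Longrightarrow> x t \<in> carrier_vec n"
    and "\<And>t. t < T \<Longrightarrow> x (Suc t) = A_true *\<^sub>v x t + B_true *\<^sub>v u t"
    and "(A_true, B_true) \<in> Sigma_cont n m"
  shows "(informative_wrt n m T u x (Sigma_cont n m) \<longleftrightarrow> informative n m T u x) \<and>
    (\<forall>K \<in> carrier_mat m n.
       (\<forall>(A, B) \<in> Sigma_D n m T u x \<inter> Sigma_cont n m. schur (A + B * K)) \<longrightarrow>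
       (\<forall>(A, B) \<in> Sigma_D n m T u x. schur (A + B * K)))"
proof -
  have "(A_true, B_true) \<in> systems n m"
    using assms(7) unfolding Sigma_cont_def by auto
  then have "(A_true, B_true) \<in> Sigma_D n m T u x"
    using assms(4-6) by (rule trajectory_in_Sigma_D)
  then have key: "\<forall>(A, B) \<in> Sigma_D n m T u x. schur (A + B * K)"
    if "K \<in> carrier_mat m n" "\<forall>(A, B) \<in> Sigma_D n m T u x \<inter> Sigma_cont n m. schur (A + B * K)" for K
    using schur_on_Sigma_D[of A_true B_true n m T u x K] that assms(7) by blast
  moreover have "Sigma_D n m T u x \<inter> systems n m = Sigma_D n m T u x"
    unfolding Sigma_D_def by auto
  \<comment> \<open>The same \<open>K\<close> works in both directions; the converse only restricts
    the set of systems.\<close>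
  ultimately show ?thesis
    unfolding informative_def informative_wrt_def by (metis IntD1)
qed

end
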